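(* Let $\mathcal{H}$ be a hypergraph with no isolated vertices. Then $$C(\mathrm{NC}(\mathcal{H}))\leq |V(\mathcal{H})|-\gamma_i(\mathcal{H})-1,$$ where $\mathrm{NC}(\mathcal{H})$ is the non-cover complex of $\mathcal{H}$, $C(\cdot)$ denotes the collapsibility number, and $\gamma_i(\mathcal{H})$ is the independence domination number of $\mathcal{H}$.
   Context: A hypergraph $\mathcal{H}$ is a pair $(V(\mathcal{H}),E(\mathcal{H}))$ with $V(\mathcal{H})$ a finite set (nonempty, identified with $[n]=\{1,\dots,n\}$ for a positive integer $n$) and $E(\mathcal{H})$ a family of subsets of $V(\mathcal{H})$ (edges, taken nonempty so that independent sets exist). A vertex $w$ is a neighbour of $v$ if there is $e\in E(\mathcal{H})$ with $\{v,w\}\subseteq e$; $N(v)$ is the set of neighbours of $v$, and $N(A)=\bigcup_{v\in A}N(v)$ for $A\subseteq V(\mathcal{H})$. A vertex $w$ is isolated if $N(w)=\emptyset$. A set $\mathcal{I}\subseteq V(\mathcal{H})$ is independent if $e\not\subseteq\mathcal{I}$ for all $e\in E(\mathcal{H})$. For $A\subseteq V(\mathcal{H})$, a set $W\subseteq V(\mathcal{H})\setminus A$ is a dominating set of $A$ if $A\subseteq N(W)$, and $\gamma_A(\mathcal{H})=\min\{|W|: W\text{ is a dominating set of }A\}$. For $\mathcal{H}$ with no isolated vertices, the independence domination number is $\gamma_i(\mathcal{H})=\max\{\gamma_{\mathcal{I}}(\mathcal{H}):\mathcal{I}\subseteq V(\mathcal{H})\text{ independent}\}$. A set $B\subseteq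 V(\mathcal{H})$ is a cover of $\mathcal{H}$ if $e\cap B\neq\emptyset$ for every $e\in E(\mathcal{H})$, and a non-cover otherwise. The non-cover complex is $\mathrm{NC}(\mathcal{H})=\{A\subseteq V(\mathcal{H}): A\text{ is a non-cover of }\mathcal{H}\}$. Simplicial complexes are finite. Let $X$ be a simplicial complex. If $\gamma,\sigma\in X$ with $|\gamma|\le d$ and $\sigma$ is the only maximal simplex of $X$ containing $\gamma$, then removing from $X$ all simplices $\tau$ with $\gamma\subseteq\tau\subseteq\sigma$ is an elementary $d$-collapse. $X$ is $d$-collapsible if some finite sequence of elementary $d$-collapses reduces $X$ to the empty (void) complex $\emptyset$. The collapsibility number $C(X)$ is the minimal integer $d$ such that $X$ is $d$-collapsible. *)

theory Defs
  imports Main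
begin

record 'a hypergraph =
  verts :: "'a set"
  edges :: "'a set set"

definition is_hypergraph :: "'a hypergraph \<Rightarrow> bool" where
  "is_hypergraph H \<longleftrightarrow>
     finite (verts H) \<and> verts H \<noteq> {} \<and> (\<forall>e\<in>edges H. e \<subseteq> verts H \<and> e \<noteq> {})"

(* The case w = v is not excluded: every vertex lying on some edge, possibly on a
   one-element edge only, is a neighbour of itself and hence is not isolated. *)
definition nbhd :: "'a hypergraph \<Rightarrow> 'a \<Rightarrow> 'a set" where
  "nbhd H v = {w \<in> verts H. \<exists>e\<in>edges H. {v, w} \<subseteq> e}"

definition nbhd_set :: "'a hypergraph \<Rightarrow> 'a set \<Rightarrow> 'a set" where
  "nbhd_set H A = (\<Union>v\<in>A. nbhd H v)"

definition isolated :: "'a hypergraph \<Rightarrow> 'a \<Rightarrow> bool" where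
  "isolated H w \<longleftrightarrow> w \<in> verts H \<and> nbhd H w = {}"

definition indep :: "'a hypergraph \<Rightarrow> 'a set \<Rightarrow> bool" where
  "indep H I \<longleftrightarrow> I \<subseteq> verts H \<and> (\<forall>e\<in>edges H. \<not> e \<subseteq> I)"

definition dominating :: "'a hypergraph \<Rightarrow> 'a set \<Rightarrow> 'a set \<Rightarrow> bool" where
  "dominating H A W \<longleftrightarrow> W \<subseteq> verts H - A \<and> A \<subseteq> nbhd_set H W"

(* Meaningful only if A has a dominating set; the lemma dominating_exists below
   guarantees this for independent A when there are no isolated vertices. *)
definition dom_number :: "'a hypergraph \<Rightarrow> 'a set \<Rightarrow> nat" where
  "dom_number H A = Min {card W | W. dominating H A W}"

definition indep_dom_number :: "'a hypergraph \<Rightarrow> nat" where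
  "indep_dom_number H = Max {dom_number H I | I. indep H I}"

definition cover :: "'a hypergraph \<Rightarrow> 'a set \<Rightarrow> bool" where
  "cover H B \<longleftrightarrow> B \<subseteq> verts H \<and> (\<forall>e\<in>edges H. e \<inter> B \<noteq> {})"

definition noncover_complex :: "'a hypergraph \<Rightarrow> 'a set set" where
  "noncover_complex H = {A. A \<subseteq> verts H \<and> \<not> cover H A}"

(* The empty set counts as a simplex, so {{}} differs from the void complex {}. *)
definition simplicial_cpx :: "'a set set \<Rightarrow> bool" where
  "simplicial_cpx X \<longleftrightarrow>
     finite X \<and> (\<forall>\<sigma>\<in>X. finite \<sigma>) \<and> (\<forall>\<sigma>\<in>X. \<forall>\<tau>. \<tau> \<subseteq> \<sigma> \<longrightarrow> \<tau> \<in> X)"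

definition maximal_simplex :: "'a set set \<Rightarrow> 'a set \<Rightarrow> bool" where
  "maximal_simplex X \<sigma> \<longleftrightarrow> \<sigma> \<in> X \<and> (\<forall>\<tau>\<in>X. \<sigma> \<subseteq> \<tau> \<longrightarrow> \<tau> = \<sigma>)"

definition elementary_collapse :: "nat \<Rightarrow> 'a set set \<Rightarrow> 'a set set \<Rightarrow> bool" where
  "elementary_collapse d X Y \<longleftrightarrow>
     (\<exists>\<gamma> \<sigma>. \<gamma> \<in> X \<and> card \<gamma> \<le> d
        \<and> maximal_simplex X \<sigma> \<and> \<gamma> \<subseteq> \<sigma>
        \<and> (\<forall>\<rho>. maximal_simplex X \<rho> \<and> \<gamma> \<subseteq> \<rho> \<longrightarrow> \<rho> = \<sigma>)
        \<and> Y = X - {\<tau>. \<gamma> \<subseteq> \<tau> \<and> \<tau> \<subseteq> \<sigma>})"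

definition collapsible :: "nat \<Rightarrow> 'a set set \<Rightarrow> bool" where
  "collapsible d X \<longleftrightarrow> (elementary_collapse d)\<^sup>*\<^sup>* X {}"

(* Meaningful for simplicial complexes X in the above sense: such an X is
   d-collapsible for every sufficiently large d. *)
definition collapsibility_number :: "'a set set \<Rightarrow> nat" where
  "collapsibility_number X = (LEAST d. collapsible d X)"

lemma dominating_exists:
  assumes "is_hypergraph H" and "\<forall>v\<in>verts H. \<not> isolated H v" and I: "indep H I"
  shows "dominating H I (verts H - I)"
proof -
  have "v \<in> nbhd_set H (verts H - I)" if v: "v \<in> I" for v
  proof -
    have "v \<in> verts H" using I v by (auto simp: indep_def)
    then obtain e where e: "e \<in> edges H" "v \<in> e"
      using assms(2) by (auto simp: isolated_def nbhd_def)
    then obtain w where "w \<in> e" "w \<notin> I" using I by (auto simp: indep_def)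
    moreover have "e \<subseteq> verts H" using e assms(1) by (auto simp: is_hypergraph_def)
    ultimately show ?thesis using e by (auto simp: nbhd_set_def nbhd_def)
  qed
  then show ?thesis by (auto simp: dominating_def)
qed

lemma simplicial_cpx_noncover_complex:
  assumes "is_hypergraph H"
  shows "simplicial_cpx (noncover_complex H)"
proof -
  have f: "finite (verts H)" using assms by (simp add: is_hypergraph_def)
  have sub: "noncover_complex H \<subseteq> Pow (verts H)" by (auto simp: noncover_complex_def)
  have "finite (noncover_complex H)"
    by (rule finite_subset[OF sub]) (simp add: f)
  moreover have "finite \<sigma>" if "\<sigma> \<in> noncover_complex H" for \<sigma>
    using finite_subset[OF _ f] sub that by blast
  moreover have "\<tau> \<in> noncover_complex H"
    if "\<sigma> \<in> noncover_complex H" "\<tau> \<subseteq> \<sigma>" for \<sigma> \<tau>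
    using that unfolding noncover_complex_def cover_def by blast
  ultimately show ?thesis unfolding simplicial_cpx_def by blast
qed

end

theory Submission
  imports Defs
begin

text \<open>
  Fix an independent set \<open>I\<close> whose domination number is maximal.  List the edges so that those
  missing \<open>I\<close> come first, and list the vertices of each edge so that those outside \<open>I\<close> come first.
  The non-covers are collapsed away along a search tree: its nodes carry a set \<open>A\<close> of chosen and a
  set \<open>Z\<close> of forbidden vertices, and one branches over the vertices by which a simplex can meet the
  next edge not yet met by \<open>A\<close>.  At a leaf some edge is contained in \<open>Z\<close>, so the simplices that
  contain \<open>A\<close> form the interval from \<open>A\<close> to \<open>V - Z\<close>, and they are removed by one collapse with
  free face \<open>A\<close> (these faces are the minimal exclusion sequences of Matousek and Tancer).

  The two orderings force the complement \<open>U\<close> of such a face to be large: a vertex \<open>v\<close> of \<open>I\<close> is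
  chosen only for an edge all of whose vertices outside \<open>I\<close> are forbidden, so \<open>v\<close> is dominated by
  \<open>U - I\<close>.  Adding one neighbour outside \<open>I\<close> for each vertex of \<open>U \<inter> I\<close> gives a dominating
  set of \<open>I\<close>, and the edge avoided at the leaf saves one further vertex.
\<close>

lemma dom_number_le_card:
  assumes "is_hypergraph H" "dominating H I W"
  shows "dom_number H I \<le> card W"
proof -
  have "finite (verts H)" using assms(1) by (simp add: is_hypergraph_def)
  then have "finite {W. dominating H I W}"
    by (rule_tac finite_subset[of _ "Pow (verts H)"]) (auto simp: dominating_def)
  then have "finite {card W | W. dominating H I W}" by simp
  then show ?thesis unfolding dom_number_def by (rule Min_le) (use assms(2) in auto)
qed

lemma indep_dom_number_attained:
  assumes "is_hypergraph H"
  obtains I where "indep H I" "indep_dom_number H = dom_number H I"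
proof -
  have "finite (verts H)" using assms by (simp add: is_hypergraph_def)
  then have "finite {I. indep H I}"
    by (rule_tac finite_subset[of _ "Pow (verts H)"]) (auto simp: indep_def)
  then have fin: "finite {dom_number H I | I. indep H I}" by simp
  have "indep H {}" using assms by (auto simp: indep_def is_hypergraph_def)
  then have ne: "{dom_number H I | I. indep H I} \<noteq> {}" by blast
  show thesis using Max_in[OF fin ne] that by (auto simp: indep_dom_number_def)
qed

text \<open>This bounds the free faces of all collapses: with \<open>A\<close> such a face and
  \<open>e\<close> the edge avoided at its leaf, it suffices to dominate \<open>I\<close> by fewer
  than \<open>card (verts H - A)\<close> vertices.\<close>

lemma dom_number_add_card_less:
  assumes H: "is_hypergraph H"
    and noiso: "\<forall>v\<in>verts H. \<not> isolated H v"
    and I: "indep H I"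
    and A: "A \<subseteq> verts H"
    and e: "e \<in> edges H" "A \<inter> e = {}"
    and meet: "A \<inter> I = {} \<or> e \<inter> I \<noteq> {}"
    and blocked: "\<forall>v\<in>A \<inter> I. \<exists>f\<in>edges H. v \<in> f \<and> (f - I) \<inter> A = {}"
  shows "dom_number H I + card A < card (verts H)"
proof -
  let ?V = "verts H" and ?U = "verts H - A"
  have finV: "finite ?V" using H by (simp add: is_hypergraph_def)
  have edge: "f \<subseteq> ?V" "f \<noteq> {}" if "f \<in> edges H" for f
    using H that by (auto simp: is_hypergraph_def)
  have IV: "I \<subseteq> ?V" using I by (simp add: indep_def)
  have out: "\<exists>w\<in>f - I. v \<in> nbhd H w" if "f \<in> edges H" "v \<in> f" for f v
  proof -
    obtain w where "w \<in> f" "w \<notin> I" using I \<open>f \<in> edges H\<close> by (auto simp: indep_def)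
    then show ?thesis using that edge by (fastforce simp: nbhd_def)
  qed
  have "\<exists>w\<in>?V - I. v \<in> nbhd H w" if "v \<in> I" for v
    using dominating_exists[OF H noiso I] that by (auto simp: dominating_def nbhd_set_def)
  then obtain w where w: "w v \<in> ?V - I" "v \<in> nbhd H (w v)" if "v \<in> I" for v
    by metis
  have "\<exists>W. dominating H I W \<and> card W < card ?U"
  proof (cases "e \<inter> I = {}")
    case True
    \<comment> \<open>By \<open>meet\<close>, \<open>A\<close> misses \<open>I\<close>; the nonempty
      edge \<open>e\<close> misses both, which makes the inclusion strict.\<close>
    have "I \<subset> ?U" using True meet e edge[OF e(1)] IV by blast
    then have "card I < card ?U" by (simp add: finV psubset_card_mono)
    moreover have "dominating H I (w ` I)"
      using w by (auto simp: dominating_def nbhd_set_def)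
    moreover have "card (w ` I) \<le> card I"
      using finite_subset[OF IV finV] by (rule card_image_le)
    ultimately show ?thesis by (meson le_less_trans)
  next
    case False
    then obtain v0 where v0: "v0 \<in> e" "v0 \<in> I" by blast
    \<comment> \<open>\<open>v0\<close> needs no extra neighbour: \<open>e - I\<close> is nonempty,
      misses \<open>A\<close> and dominates it. This is the vertex saved.\<close>
    let ?R = "?U \<inter> I - {v0}"
    let ?W = "(?U - I) \<union> w ` ?R"
    have "v \<in> nbhd_set H ?W" if v: "v \<in> I" for v
    proof (cases "v \<in> ?R")
      case True
      then show ?thesis using w by (auto simp: nbhd_set_def)
    next
      case False
      \<comment> \<open>Either \<open>v\<close> lies in \<open>A\<close> and \<open>blocked\<close>
        applies, or \<open>v\<close> is \<open>v0\<close> and \<open>e\<close> serves as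
        \<open>f\<close>.\<close>
      then have "\<exists>f\<in>edges H. v \<in> f \<and> (f - I) \<inter> A = {}"
        using v v0 IV e blocked by blast
      then obtain f where f: "f \<in> edges H" "v \<in> f" "(f - I) \<inter> A = {}" by blast
      obtain u where "u \<in> f - I" "v \<in> nbhd H u" using out f by blast
      moreover from this have "u \<in> ?U - I" using f edge by blast
      ultimately show ?thesis by (auto simp: nbhd_set_def)
    qed
    then have "dominating H I ?W" using w by (auto simp: dominating_def)
    moreover have "card ?W < card ?U"
    proof -
      have "card ?W \<le> card (?U - I) + card (w ` ?R)" by (rule card_Un_le)
      also have "card (w ` ?R) \<le> card ?R" by (rule card_image_le) (simp add: finV)
      also have "card (?U - I) + card ?R = card ((?U - I) \<union> ?R)"
        by (rule card_Un_disjoint[symmetric]) (auto simp: finV)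
      also have "\<dots> < card ?U"
      proof (rule psubset_card_mono)
        have "v0 \<in> ?U" using v0 e edge[OF e(1)] by blast
        then show "(?U - I) \<union> ?R \<subset> ?U" using v0 by blast
      qed (simp add: finV)
      finally show ?thesis by simp
    qed
    ultimately show ?thesis by blast
  qed
  then obtain W where "dominating H I W" "card W < card ?U" by blast
  then have "dom_number H I < card ?U"
    using dom_number_le_card[OF H] by (meson le_less_trans)
  moreover have "card ?U + card A = card ?V"
    using A finV by (metis card_Diff_subset card_mono finite_subset le_add_diff_inverse2)
  ultimately show ?thesis by linarith
qed

text \<open>\<open>S\<close> lies in \<open>X\<close> and contains every simplex above
  \<open>A\<close>, so it is the only maximal simplex above \<open>A\<close>.\<close>

lemma elementary_collapse_interval:
  assumes "{\<tau>\<in>X. A \<subseteq> \<tau>} = {\<tau>. A \<subseteq> \<tau> \<and> \<tau> \<subseteq> S}" "A \<subseteq> S" "card A \<le> d"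
  shows "elementary_collapse d X {\<tau>\<in>X. \<not> A \<subseteq> \<tau>}"
proof -
  have iff: "\<tau> \<in> X \<longleftrightarrow> \<tau> \<subseteq> S" if "A \<subseteq> \<tau>" for \<tau>
    using assms(1) that by blast
  have "A \<in> X" "S \<in> X" using iff assms(2) by auto
  moreover have "maximal_simplex X S"
    unfolding maximal_simplex_def using iff assms(2) by blast
  moreover have "\<rho> = S" if "maximal_simplex X \<rho>" "A \<subseteq> \<rho>" for \<rho>
    using that iff \<open>S \<in> X\<close> unfolding maximal_simplex_def by blast
  moreover have "{\<tau>\<in>X. \<not> A \<subseteq> \<tau>} = X - {\<tau>. A \<subseteq> \<tau> \<and> \<tau> \<subseteq> S}"
    using iff by blast
  ultimately show ?thesis
    unfolding elementary_collapse_def using assms(2,3) by blast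
qed

text \<open>
  Since \<open>A\<close> meets the edges already treated, the simplices of \<open>X\<close> above \<open>A\<close> are exactly the sets
  between \<open>A\<close> and \<open>V - Z\<close> that miss an edge of the remaining list; this equation is the invariant
  of the recursion.
\<close>

lemma collapse_above:
  fixes V I :: "'a set"
  assumes finV: "finite V"
    and bound: "\<And>A e. \<lbrakk>A \<subseteq> V; e \<in> E; A \<inter> e = {}; A \<inter> I = {} \<or> e \<inter> I \<noteq> {};
                  \<forall>v\<in>A \<inter> I. \<exists>f\<in>E. v \<in> f \<and> (f - I) \<inter> A = {}\<rbrakk> \<Longrightarrow> card A \<le> d"
    and EV: "\<And>e. e \<in> E \<Longrightarrow> e \<subseteq> V"
  shows "\<lbrakk>set es \<subseteq> E; sorted_wrt (\<lambda>e f. e \<inter> I \<noteq> {} \<longrightarrow> f \<inter> I \<noteq> {}) es;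
      A \<subseteq> V; A \<inter> Z = {};
      A \<inter> I = {} \<or> (\<forall>e\<in>set es. e \<inter> I \<noteq> {});
      \<forall>v\<in>A \<inter> I. \<exists>f\<in>E. v \<in> f \<and> f - I \<subseteq> Z;
      {\<tau>\<in>X. A \<subseteq> \<tau>} = {\<tau>. A \<subseteq> \<tau> \<and> \<tau> \<subseteq> V - Z \<and> (\<exists>e\<in>set es. e \<inter> \<tau> = {})}\<rbrakk>
    \<Longrightarrow> (elementary_collapse d)\<^sup>*\<^sup>* X {\<tau>\<in>X. \<not> A \<subseteq> \<tau>}"
proof (induction es arbitrary: A Z X)
  case Nil
  then have "{\<tau>\<in>X. \<not> A \<subseteq> \<tau>} = X" by auto
  then show ?case by simp
next
  case (Cons e es)
  note outer_IH = Cons.IH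
  have tail: "set es \<subseteq> E" "sorted_wrt (\<lambda>e f. e \<inter> I \<noteq> {} \<longrightarrow> f \<inter> I \<noteq> {}) es"
    and eE: "e \<in> E"
    and later: "\<forall>f\<in>set es. e \<inter> I \<noteq> {} \<longrightarrow> f \<inter> I \<noteq> {}"
    using Cons.prems(1,2) by auto
  from Cons.prems(3-) show ?case
  \<comment> \<open>Forbidding a vertex of \<open>e\<close> keeps the edge list, so that branch
    recurses on the number of vertices of \<open>e\<close> still allowed; choosing one passes to
    \<open>es\<close>.\<close>
  proof (induction "card (e - Z)" arbitrary: A Z X rule: less_induct)
    case less
    note inner_IH = less.hyps
    note A = \<open>A \<subseteq> V\<close> and AZ = \<open>A \<inter> Z = {}\<close> and blocked = less.prems(4) and X = less.prems(5)
    consider "A \<inter> e \<noteq> {}" | "A \<inter> e = {}" "e \<subseteq> Z" | "A \<inter> e = {}" "\<not> e \<subseteq> Z" by blast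
    then show ?case
    proof cases
      case 1
      then have "{\<tau>\<in>X. A \<subseteq> \<tau>} =
          {\<tau>. A \<subseteq> \<tau> \<and> \<tau> \<subseteq> V - Z \<and> (\<exists>e\<in>set es. e \<inter> \<tau> = {})}"
        unfolding X by auto
      moreover have "A \<inter> I = {} \<or> (\<forall>f\<in>set es. f \<inter> I \<noteq> {})"
        using less.prems(3) by auto
      ultimately show ?thesis
        by (rule_tac outer_IH[OF tail A AZ _ blocked])
    next
      case 2
      have "card A \<le> d"
      proof (rule bound[OF A eE 2(1)])
        show "A \<inter> I = {} \<or> e \<inter> I \<noteq> {}" using less.prems(3) by auto
        have "(f - I) \<inter> A = {}" if "f - I \<subseteq> Z" for f using that AZ by blast
        then show "\<forall>v\<in>A \<inter> I. \<exists>f\<in>E. v \<in> f \<and> (f - I) \<inter> A = {}"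
          using blocked by meson
      qed
      \<comment> \<open>Every subset of \<open>V - Z\<close> misses \<open>e\<close>, so the
        existential condition in the invariant is automatic.\<close>
      moreover have "{\<tau>\<in>X. A \<subseteq> \<tau>} = {\<tau>. A \<subseteq> \<tau> \<and> \<tau> \<subseteq> V - Z}"
        unfolding X using 2(2) by auto
      moreover have "A \<subseteq> V - Z" using A AZ by blast
      ultimately show ?thesis
        by (intro r_into_rtranclp elementary_collapse_interval)
    next
      case 3
      \<comment> \<open>Vertices outside \<open>I\<close> are taken first, so for \<open>x\<close>
        in \<open>I\<close> the edge \<open>e\<close> itself is the witness that the blocking
        condition asks for.\<close>
      obtain x where x: "x \<in> e - Z" "x \<in> I \<Longrightarrow> e - I \<subseteq> Z"
        using 3(2) by (cases "e - I \<subseteq> Z") auto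
      \<comment> \<open>Once the simplices containing \<open>insert x A\<close> are gone, those left
        above \<open>A\<close> avoid \<open>x\<close>, so \<open>x\<close> can join
        \<open>Z\<close>.\<close>
      define Y where "Y = {\<tau>\<in>X. \<not> insert x A \<subseteq> \<tau>}"
      have "(elementary_collapse d)\<^sup>*\<^sup>* X Y"
        unfolding Y_def
      proof (rule outer_IH[OF tail, of _ Z])
        show "insert x A \<subseteq> V" using x EV[OF eE] A by blast
        show "insert x A \<inter> Z = {}" using x AZ by blast
        \<comment> \<open>If \<open>x\<close> is in \<open>I\<close>, then \<open>e\<close> meets
          \<open>I\<close>, and by the sorting so do all later edges.\<close>
        show "insert x A \<inter> I = {} \<or> (\<forall>f\<in>set es. f \<inter> I \<noteq> {})"
          using x later less.prems(3) by auto
        show "\<forall>v\<in>insert x A \<inter> I. \<exists>f\<in>E. v \<in> f \<and> f - I \<subseteq> Z"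
        proof
          fix v assume "v \<in> insert x A \<inter> I"
          then consider "v = x" "x \<in> I" | "v \<in> A \<inter> I" by blast
          then show "\<exists>f\<in>E. v \<in> f \<and> f - I \<subseteq> Z"
            by cases (use x eE blocked in auto)
        qed
        show "{\<tau>\<in>X. insert x A \<subseteq> \<tau>} =
            {\<tau>. insert x A \<subseteq> \<tau> \<and> \<tau> \<subseteq> V - Z \<and> (\<exists>e\<in>set es. e \<inter> \<tau> = {})}"
        proof -
          have "{\<tau>\<in>X. insert x A \<subseteq> \<tau>} = {\<tau>\<in>{\<tau>\<in>X. A \<subseteq> \<tau>}. x \<in> \<tau>}" by auto
          also have "\<dots> = {\<tau>. insert x A \<subseteq> \<tau> \<and> \<tau> \<subseteq> V - Z \<and> (\<exists>e\<in>set es. e \<inter> \<tau> = {})}"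
            unfolding X using x(1) by auto
          finally show ?thesis .
        qed
      qed
      also have "(elementary_collapse d)\<^sup>*\<^sup>* Y {\<tau>\<in>Y. \<not> A \<subseteq> \<tau>}"
      proof (rule inner_IH[of "insert x Z"])
        have "finite e" using EV[OF eE] finV by (rule finite_subset)
        then show "card (e - insert x Z) < card (e - Z)"
          using x by (intro psubset_card_mono) auto
        show "A \<inter> insert x Z = {}" using x AZ 3(1) by blast
        show "\<forall>v\<in>A \<inter> I. \<exists>f\<in>E. v \<in> f \<and> f - I \<subseteq> insert x Z"
          using blocked by (meson subset_insertI2)
        have "{\<tau>\<in>Y. A \<subseteq> \<tau>} = {\<tau>\<in>{\<tau>\<in>X. A \<subseteq> \<tau>}. x \<notin> \<tau>}" by (auto simp: Y_def)
        also have "\<dots> =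
            {\<tau>. A \<subseteq> \<tau> \<and> \<tau> \<subseteq> V - insert x Z \<and> (\<exists>e\<in>set (e # es). e \<inter> \<tau> = {})}"
          unfolding X by auto
        finally show "{\<tau>\<in>Y. A \<subseteq> \<tau>} = \<dots>" .
      qed (use A less.prems(3) in auto)
      also have "{\<tau>\<in>Y. \<not> A \<subseteq> \<tau>} = {\<tau>\<in>X. \<not> A \<subseteq> \<tau>}" by (auto simp: Y_def)
      finally show ?thesis .
    qed
  qed
qed

theorem theorem2p3:
  fixes H :: "'a hypergraph"
  assumes "is_hypergraph H"
    and "\<forall>v\<in>verts H. \<not> isolated H v"
  shows "int (collapsibility_number (noncover_complex H))
           \<le> int (card (verts H)) - int (indep_dom_number H) - 1"
proof -
  let ?V = "verts H" and ?E = "edges H"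
  obtain I where I: "indep H I" "indep_dom_number H = dom_number H I"
    using indep_dom_number_attained[OF assms(1)] .
  note bound = dom_number_add_card_less[OF assms I(1)]
  define d where "d = card ?V - dom_number H I - 1"
  have EV: "e \<subseteq> ?V" if "e \<in> ?E" for e
    using assms(1) that by (auto simp: is_hypergraph_def)
  have "finite ?V" "?V \<noteq> {}" using assms(1) by (auto simp: is_hypergraph_def)
  then obtain e where "e \<in> ?E" using assms(2) by (auto simp: isolated_def nbhd_def)
  \<comment> \<open>The case of the empty face; it ensures that the natural subtractions in
    \<open>d\<close> do not truncate.\<close>
  then have less: "dom_number H I < card ?V" using bound[of "{}" e] by simp
  have "?E \<subseteq> Pow ?V" using EV by blast
  then have finE: "finite ?E" by (rule finite_subset) (simp add: \<open>finite ?V\<close>)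
  obtain es1 where es1: "set es1 = {e\<in>?E. e \<inter> I = {}}"
    using finite_list[of "{e\<in>?E. e \<inter> I = {}}"] finE by auto
  obtain es2 where es2: "set es2 = {e\<in>?E. e \<inter> I \<noteq> {}}"
    using finite_list[of "{e\<in>?E. e \<inter> I \<noteq> {}}"] finE by auto
  have es: "set (es1 @ es2) = ?E" using es1 es2 by auto
  \<comment> \<open>At the root of the tree \<open>A\<close> is empty and lies in every simplex, so
    the complex left over is void.\<close>
  have "(elementary_collapse d)\<^sup>*\<^sup>* (noncover_complex H) {\<tau>\<in>noncover_complex H. \<not> {} \<subseteq> \<tau>}"
  proof (rule collapse_above[where V = ?V and E = ?E and I = I and es = "es1 @ es2" and Z = "{}"])
    show "card A \<le> d"
      if "A \<subseteq> ?V" "e \<in> ?E" "A \<inter> e = {}" "A \<inter> I = {} \<or> e \<inter> I \<noteq> {}"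
        "\<forall>v\<in>A \<inter> I. \<exists>f\<in>?E. v \<in> f \<and> (f - I) \<inter> A = {}" for A e
      using bound[OF that] by (simp add: d_def)
    show "sorted_wrt (\<lambda>e f. e \<inter> I \<noteq> {} \<longrightarrow> f \<inter> I \<noteq> {}) (es1 @ es2)"
    proof -
      have "e \<inter> I = {}" if "e \<in> set es1" for e using that es1 by simp
      then have "sorted_wrt (\<lambda>e f. e \<inter> I \<noteq> {} \<longrightarrow> f \<inter> I \<noteq> {}) es1"
        by (induction es1) auto
      moreover have "e \<inter> I \<noteq> {}" if "e \<in> set es2" for e using that es2 by simp
      then have "sorted_wrt (\<lambda>e f. e \<inter> I \<noteq> {} \<longrightarrow> f \<inter> I \<noteq> {}) es2"
        by (induction es2) auto
      ultimately show ?thesis by (simp add: sorted_wrt_append es1 es2)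
    qed
    show "{\<tau>\<in>noncover_complex H. {} \<subseteq> \<tau>} =
        {\<tau>. {} \<subseteq> \<tau> \<and> \<tau> \<subseteq> ?V - {} \<and> (\<exists>e\<in>set (es1 @ es2). e \<inter> \<tau> = {})}"
      unfolding es by (auto simp: noncover_complex_def cover_def)
  qed (use \<open>finite ?V\<close> EV es in auto)
  then have "collapsible d (noncover_complex H)" by (simp add: collapsible_def)
  then have "collapsibility_number (noncover_complex H) \<le> d"
    unfolding collapsibility_number_def by (rule Least_le)
  then show ?thesis using less by (simp add: d_def I(2))
qed

end
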